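(* Let $X\subset\mathbb{R}^n$ be a bounded convex set, let $f:X\to\mathbb{R}$ and $g_j:X\to\mathbb{R}$ ($j=1,\dots,m$) be convex, $g=[g_1,\dots,g_m]^T$, and let $\delta\in\mathbb{R}^m$. Consider the problem $\mathcal P(\delta)$ of minimizing $f(x)$ over $x\in X$ subject to $g(x)+\delta\preceq 0$, with feasible set $X_0(\delta)=\{x\in X: g(x)+\delta\preceq 0\}$ and optimal value $f^\star(\delta)$, and consider the update $$\lambda_{k+1}=[\lambda_k+\alpha(g(x_k)+\delta_k)]^+,\qquad x_k\in\arg\min_{x\in X}L(x,\mu_k,\delta_k),\qquad k=1,2,\dots$$ where $\alpha>0$ is a constant step size, $\mu_k=\lambda_k+\epsilon_k$ with $\lambda_1\in\mathbb{R}^m_+$, and $\{\epsilon_k\}$ is a sequence of points from $\mathbb{R}^m$ such that $\mu_k\succeq 0$ for all $k$. Suppose $X_0(\delta)$ has nonempty relative interior (the Slater condition is satisfied) and that $\delta_k$ is an ergodic stochastic process with expected value $\delta$ and $\mathbf{E}(\|\delta_k-\delta\|_2^2)=\sigma_\delta^2$ for some finite $\sigma_\delta^2$. Further, suppose that $\lim_{k\to\infty}k^{-1}\sum_{i=1}^k\|\epsilon_i\|_2=\epsilon$ for some $\epsilon\ge 0$. Then (i) $\displaystyle \mathbf{E}\left(f(\bar x_k)-f^\star(\delta)\right)\le\frac{\alpha\Theta}{2}+\frac{\|\lambda_1\|_2^2}{2\alpha k}+\frac{2}{k}\sum_{i=1}^k\|\epsilon_i\|_2\sigma_g$; (ii)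 $\displaystyle \mathbf{E}\left(f(\bar x_k)-f^\star(\delta)\right)\ge-\frac{\Omega+\|\mathbf{E}(\bar\lambda_k)\|_2\left(\|\lambda^\star(\delta)\|_2+\sqrt{\Omega}\right)}{\alpha k}$; (iii) $\displaystyle \left\|\mathbf{E}\left(g(\bar x_k)+\delta\right)\right\|_2\le\frac{1}{\alpha k}\left(\|\lambda^\star(\delta)\|_2+\sqrt{\Omega}\right)$; (iv) $\displaystyle \left\|\mathbf{E}(\bar\lambda_k)\right\|_2\le\frac{1}{\upsilon}\left(f(\hat x)-h(\lambda^\star(\delta),\delta)+\frac{\Omega}{\alpha k}\right)$, where $\bar x_k=k^{-1}\sum_{i=1}^k x_i$, $\bar\lambda_k=k^{-1}\sum_{i=1}^k\lambda_i$, $\Theta=\sigma_g^2+\sigma_\delta^2$, $\hat x$ is a Slater point (i.e., $g(\hat x)\prec 0$), $\upsilon=\min_{j\in\{1,\dots,m\}}-g_j(\hat x)$, and $$\Omega=\|\lambda_1-\lambda^\star(\delta)\|_2^2+\alpha^2\Theta k+2\alpha\sum_{i=1}^k\|\epsilon_i\|_2\sigma_g .$$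
   Context: For vectors, $x\preceq y$ (resp. $x\prec y$) means $x(j)\le y(j)$ (resp. $x(j)<y(j)$) for all components $j$; $[x]^+$ is the componentwise maximum of $x$ and $0$. The Lagrangian is $L(x,\lambda,\delta)=f(x)+\lambda^T(g(x)+\delta)$, the Lagrange dual function is $h(\lambda,\delta)=\inf_{x\in X}L(x,\lambda,\delta)$, and $\lambda^\star(\delta)$ is a vector in $\arg\max_{\lambda\succeq 0}h(\lambda,\delta)$. The constant $\sigma_g$ is a finite upper bound on $\|g(x)+\delta\|_2$ over $x\in X$. Expectations are taken with respect to $\delta_1,\dots,\delta_k$; ergodic here includes $\mathbf{E}(\delta_k)=\delta$ for all $k$, and $\delta_k$ is taken to be independent of $\lambda_k$ and of $x_k$ for every $k$.
   Formalization: Proved with (iii) bounding ‖[E(g(x̄_k)+δ)]^+‖ instead of ‖E(g(x̄_k)+δ)‖, and in (iv) with x̂ ∈ X, g(x̂)+δ≺0 and υ=min_j −(g_j(x̂)+δ_j); both printed forms fail for X={0}, f=0, g=−1000, δ_k=δ=999, α=λ_1=σ_g=1, ε_k=0. f, g are assumed Borel on X. *)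

theory Defs
  imports "HOL-Probability.Probability"
begin

definition lagrangian ::
  "('a \<Rightarrow> real) \<Rightarrow> ('a \<Rightarrow> real ^ 'm) \<Rightarrow> 'a \<Rightarrow> real ^ 'm \<Rightarrow> real ^ 'm \<Rightarrow> real"
  where "lagrangian f g x l d = f x + l \<bullet> (g x + d)"

text \<open>
  The infima in \<open>dual_fun\<close> and \<open>opt_value\<close> are infima of real sets, so they are meaningful only if
  the set is nonempty and bounded below. This holds whenever some Lagrangian attains its
  minimum over \<open>X\<close> and \<open>g\<close> is bounded on \<open>X\<close> (and, for \<open>opt_value\<close>, the problem is feasible).
\<close>

definition dual_fun ::
  "'a set \<Rightarrow> ('a \<Rightarrow> real) \<Rightarrow> ('a \<Rightarrow> real ^ 'm) \<Rightarrow> real ^ 'm \<Rightarrow> real ^ 'm \<Rightarrow> real"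
  where "dual_fun X f g l d = (INF x\<in>X. lagrangian f g x l d)"

definition feasible_set :: "'a set \<Rightarrow> ('a \<Rightarrow> real ^ 'm) \<Rightarrow> real ^ 'm \<Rightarrow> 'a set"
  where "feasible_set X g d = {x \<in> X. g x + d \<le> 0}"

definition opt_value ::
  "'a set \<Rightarrow> ('a \<Rightarrow> real) \<Rightarrow> ('a \<Rightarrow> real ^ 'm) \<Rightarrow> real ^ 'm \<Rightarrow> real"
  where "opt_value X f g d = (INF x\<in>feasible_set X g d. f x)"

text \<open>
  Slater points of the perturbed problem, whose constraint function is \<open>\<lambda>x. g x + d\<close>.
  The library's \<open><\<close> on \<open>real ^ 'm\<close> is not strict in every component, hence the quantifier.
\<close>

definition slater_point :: "'a set \<Rightarrow> ('a \<Rightarrow> real ^ 'm) \<Rightarrow> real ^ 'm \<Rightarrow> 'a \<Rightarrow> bool"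
  where "slater_point X g d x \<longleftrightarrow> x \<in> X \<and> (\<forall>j. (g x + d) $ j < 0)"

definition slater_margin :: "('a \<Rightarrow> real ^ 'm) \<Rightarrow> real ^ 'm \<Rightarrow> 'a \<Rightarrow> real"
  where "slater_margin g d x = Min (range (\<lambda>j. - ((g x + d) $ j)))"

definition pos_part :: "real ^ 'm \<Rightarrow> real ^ 'm"
  where "pos_part v = (\<chi> j. max (v $ j) 0)"

definition running_avg :: "(nat \<Rightarrow> 'a::real_vector) \<Rightarrow> nat \<Rightarrow> 'a"
  where "running_avg u k = (1 / real k) *\<^sub>R (\<Sum>i=1..k. u i)"

text \<open>
  The library's \<open>indep_var\<close> requires both variables to have the same value type; this is the
  same condition (cf. \<open>indep_var_eq\<close>) for Borel variables of different types.
\<close>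

definition indep_rvs ::
  "'w measure \<Rightarrow> ('w \<Rightarrow> 'a::topological_space) \<Rightarrow> ('w \<Rightarrow> 'b::topological_space) \<Rightarrow> bool"
  where "indep_rvs M U V \<longleftrightarrow>
    U \<in> borel_measurable M \<and> V \<in> borel_measurable M \<and>
    prob_space.indep_set M
      (sigma_sets (space M) {U -` A \<inter> space M | A. A \<in> sets borel})
      (sigma_sets (space M) {V -` A \<inter> space M | A. A \<in> sets borel})"

text \<open>
  Ergodicity in the mean: every variable has mean \<open>d\<close> and the time averages converge to \<open>d\<close>.
  Convergence is in probability, which is implied both by almost sure and by mean-square
  convergence of the time averages.
\<close>

definition ergodic_process ::
  "'w measure \<Rightarrow> (nat \<Rightarrow> 'w \<Rightarrow> 'b::euclidean_space) \<Rightarrow> 'b \<Rightarrow> bool"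
  where "ergodic_process M D d \<longleftrightarrow>
    (\<forall>k\<ge>1. integrable M (D k) \<and> integral\<^sup>L M (D k) = d) \<and>
    (\<forall>r>0. (\<lambda>k. measure M {\<omega> \<in> space M. dist (running_avg (\<lambda>i. D i \<omega>) k) d > r})
              \<longlonglongrightarrow> 0)"

end

theory Submission
  imports Defs
begin

text \<open>
  For every fixed \<open>v \<ge> 0\<close> the squared distance of \<open>\<lambda>\<^sub>k\<close> to \<open>v\<close> grows in one step, in expectation, by at
  most \<open>2\<alpha> E ((\<lambda>\<^sub>k - v) \<bullet> (g x\<^sub>k + \<delta>)) + \<alpha>\<^sup>2 \<Theta>\<close>, because independence removes the terms linear in the
  noise \<open>\<delta>\<^sub>k - \<delta>\<close>. With \<open>v = 0\<close> and the optimality of \<open>x\<^sub>k\<close> this gives (i). With \<open>v = \<lambda>\<^sup>\<star>\<close> it gives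
  \<open>E \<parallel>\<lambda>\<^sub>k\<^sub>+\<^sub>1 - \<lambda>\<^sup>\<star>\<parallel>\<^sup>2 \<le> \<Omega>\<close>, hence (iii), as \<open>\<lambda>\<^sub>k\<^sub>+\<^sub>1\<close> dominates \<open>\<alpha>\<close> times the accumulated constraint values.
  Bounding the linear terms by \<open>f y + \<lambda>\<^sub>k \<bullet> (g y + \<delta>) - h(\<lambda>\<^sup>\<star>, \<delta>)\<close> instead yields
  \<open>h(\<lambda>\<^sup>\<star>, \<delta>) - \<Omega> / (\<alpha>k) \<le> f y + E \<lambda>bar\<^sub>k \<bullet> (g y + \<delta>)\<close> for every \<open>y \<in> X\<close>: the Slater point as \<open>y\<close> gives (iv), and
  \<open>y = xbar\<^sub>k\<close>, taken in expectation together with strong duality and (iii), gives (ii).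
\<close>

section \<open>The componentwise order and the positive part\<close>

lemma zero_le_vec_iff: "0 \<le> (v :: real ^ 'm) \<longleftrightarrow> (\<forall>j. 0 \<le> v $ j)"
  by (simp add: less_eq_vec_def)

lemma inner_vec_mono:
  fixes u v w :: "real ^ 'm"
  assumes "0 \<le> w" "u \<le> v"
  shows "w \<bullet> u \<le> w \<bullet> v"
  using assms by (auto simp: inner_vec_def less_eq_vec_def intro!: sum_mono mult_left_mono)

lemma pos_part_nonneg: "0 \<le> pos_part v"
  by (simp add: pos_part_def zero_le_vec_iff)

lemma pos_part_ge: "v \<le> pos_part v"
  by (simp add: pos_part_def less_eq_vec_def)

lemma norm_vec_mono:
  fixes u v :: "real ^ 'm"
  assumes "0 \<le> u" "u \<le> v"
  shows "norm u \<le> norm v"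
proof (rule norm_le_componentwise_cart)
  fix j
  have "0 \<le> u $ j" "u $ j \<le> v $ j" using assms by (simp_all add: less_eq_vec_def)
  then show "norm (u $ j) \<le> norm (v $ j)" by simp
qed

text \<open>\<open>pos_part v\<close> is the least nonnegative upper bound of \<open>v\<close>, and
  the norm is monotone on nonnegative vectors. This turns a componentwise upper bound on the mean
  constraint value into a norm bound.\<close>

lemma norm_pos_part_le:
  assumes "v \<le> w" "0 \<le> w"
  shows "norm (pos_part v) \<le> norm w"
  by (rule norm_vec_mono) (use assms in \<open>auto simp: pos_part_def less_eq_vec_def\<close>)

text \<open>The positive part is the projection onto the nonnegative orthant: it is nonexpansive and
  fixes \<open>w\<close>.\<close>

lemma norm_pos_part_diff_le:
  assumes "0 \<le> w"
  shows "norm (pos_part v - w) \<le> norm (v - w)"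
proof (rule norm_le_componentwise_cart)
  fix j
  show "norm ((pos_part v - w) $ j) \<le> norm ((v - w) $ j)"
    using assms by (auto simp: pos_part_def zero_le_vec_iff max_def)
qed

lemma norm_le_sum_nonneg:
  fixes v :: "real ^ 'm"
  assumes "0 \<le> v"
  shows "norm v \<le> (\<Sum>j\<in>UNIV. v $ j)"
  using norm_le_l1_cart[of v] assms by (simp add: zero_le_vec_iff)

section \<open>Slater points and strong duality\<close>

lemma slater_margin_pos:
  assumes "slater_point X g d y"
  shows "slater_margin g d y > 0"
proof -
  have "0 < - ((g y + d) $ j)" for j
    using assms by (simp only: slater_point_def neg_0_less_iff_less)
  then show ?thesis
    by (auto simp: slater_margin_def)
qed

text \<open>Each component of \<open>- (g y + d)\<close> is at least the margin, so the negated
  inner product is at least the margin times the l1 norm of \<open>v\<close>, which dominates the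
  Euclidean norm.\<close>

lemma slater_margin_norm_le:
  assumes "0 \<le> v" and sl: "slater_point X g d y"
  shows "slater_margin g d y * norm v \<le> - (v \<bullet> (g y + d))"
proof -
  have "slater_margin g d y * norm v \<le> slater_margin g d y * (\<Sum>j\<in>UNIV. v $ j)"
    using slater_margin_pos[OF sl] norm_le_sum_nonneg[OF assms(1)] by (simp add: mult_left_mono)
  also have "\<dots> = (\<Sum>j\<in>UNIV. v $ j * slater_margin g d y)"
    by (simp add: sum_distrib_left mult.commute)
  also have "\<dots> \<le> (\<Sum>j\<in>UNIV. v $ j * (- ((g y + d) $ j)))"
    using assms unfolding slater_margin_def zero_le_vec_iff
    by (intro sum_mono mult_left_mono Min_le) auto
  also have "\<dots> = - (v \<bullet> (g y + d))"
    by (simp only: inner_vec_def inner_real_def mult_minus_right sum_negf)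
  finally show ?thesis .
qed

lemma dual_fun_le:
  assumes "bdd_below ((\<lambda>y. lagrangian f g y l d) ` X)" "y \<in> X"
  shows "dual_fun X f g l d \<le> f y + l \<bullet> (g y + d)"
  using cINF_lower[OF assms] by (simp add: dual_fun_def lagrangian_def)

text \<open>A hyperplane separates the point \<open>(0, fs)\<close> from the convex set of pairs
  dominating the attainable constraint and objective values. The Slater point rules out a vertical
  hyperplane, so its normal can be scaled to have last coordinate 1, and the remaining coordinates
  are a multiplier without duality gap.\<close>

lemma slater_strong_duality:
  fixes g :: "'a::real_vector \<Rightarrow> real ^ 'm"
  assumes f: "convex_on X f" and g: "\<And>j. convex_on X (\<lambda>y. g y $ j)"
    and sl: "slater_point X g d xhat"
    and bdd: "bdd_below (f ` X)"
  obtains l where "0 \<le> l" "opt_value X f g d \<le> dual_fun X f g l d"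
proof -
  define fs where "fs = opt_value X f g d"
  \<comment> \<open>The inequality in \<open>t\<close> is strict so that \<open>(0, fs)\<close> lies
    outside \<open>A\<close> even when the optimal value is attained.\<close>
  define A where "A = {(u :: real ^ 'm, t :: real). \<exists>y\<in>X. g y + d \<le> u \<and> f y < t}"
  have "convex X" using f by (simp add: convex_on_def)
  have xh: "xhat \<in> X" "\<And>j. (g xhat + d) $ j < 0"
    using sl by (auto simp: slater_point_def)
  have fs_le: "fs \<le> f y" if "y \<in> X" "g y + d \<le> 0" for y
    unfolding fs_def opt_value_def
    by (rule cINF_lower) (use that bdd in \<open>auto simp: feasible_set_def intro: bdd_below_mono\<close>)
  have cA: "convex A"
    unfolding convex_def
  proof clarify
    fix u t u' t' and a b :: real
    assume "(u, t) \<in> A" "(u', t') \<in> A" and ab: "0 \<le> a" "0 \<le> b" "a + b = 1"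
    then obtain y y' where y: "y \<in> X" "g y + d \<le> u" "f y < t" "y' \<in> X" "g y' + d \<le> u'" "f y' < t'"
      by (auto simp: A_def)
    let ?z = "a *\<^sub>R y + b *\<^sub>R y'"
    have z: "?z \<in> X" using \<open>convex X\<close> y ab by (simp add: convex_def)
    have "g ?z + d \<le> a *\<^sub>R u + b *\<^sub>R u'"
      unfolding less_eq_vec_def
    proof
      fix j
      have "g ?z $ j \<le> a * (g y $ j) + b * (g y' $ j)"
        using g[of j] y ab by (simp add: convex_on_def)
      also have "a * (g y $ j) \<le> a * (u $ j - d $ j)"
        using y(2) ab by (intro mult_left_mono) (auto simp: less_eq_vec_def algebra_simps)
      also have "b * (g y' $ j) \<le> b * (u' $ j - d $ j)"
        using y(5) ab by (intro mult_left_mono) (auto simp: less_eq_vec_def algebra_simps)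
      finally have "g ?z $ j \<le> a * u $ j + b * u' $ j - (a + b) * d $ j"
        by (simp add: algebra_simps)
      then show "(g ?z + d) $ j \<le> (a *\<^sub>R u + b *\<^sub>R u') $ j"
        using ab by simp
    qed
    moreover have "f ?z < a * t + b * t'"
    proof -
      have "f ?z \<le> a * f y + b * f y'"
        using f y ab by (simp add: convex_on_def)
      \<comment> \<open>One strictly weighted term suffices for strictness: the second one if
        \<open>a = 0\<close>, when \<open>b = 1\<close>, and the first one otherwise.\<close>
      also have "\<dots> < a * t + b * t'"
      proof (cases "a = 0")
        case True then show ?thesis using ab y by simp
      next
        case False
        then have "a * f y < a * t" using ab y by simp
        moreover have "b * f y' \<le> b * t'" using ab y by (simp add: mult_left_mono)
        ultimately show ?thesis by simp
      qed
      finally show ?thesis .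
    qed
    ultimately show "a *\<^sub>R (u, t) + b *\<^sub>R (u', t') \<in> A"
      using z by (auto simp: A_def)
  qed
  have in_A: "(u, t) \<in> A" if "y \<in> X" "g y + d \<le> u" "f y < t" for y u t
    using that by (auto simp: A_def)
  have "(g xhat + d, f xhat + 1) \<in> A"
    by (rule in_A[OF xh(1)]) auto
  then have "A \<noteq> {}" by blast
  moreover have "{(0, fs)} \<inter> A = {}"
    using fs_le by (force simp: A_def)
  ultimately obtain p b where p: "p \<noteq> 0" "p \<bullet> (0, fs) \<le> b" "\<forall>z\<in>A. b \<le> p \<bullet> z"
    using separating_hyperplane_sets[of "{(0, fs)}" A] cA by auto
  obtain l r where lr: "p = (l, r)" by force
  have key: "r * fs \<le> l \<bullet> u + r * t" if "y \<in> X" "g y + d \<le> u" "f y < t" for y u t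
    using p(2,3) in_A[OF that] lr by fastforce
  have r0: "0 \<le> r"
  proof (rule ccontr)
    assume r: "\<not> 0 \<le> r"
    \<comment> \<open>\<open>A\<close> is unbounded in the direction of growing \<open>t\<close>, so
      a negative \<open>r\<close> would push the functional below \<open>r * fs\<close>. The
      quotient is where it falls short by 1; the maximum keeps the pair in \<open>A\<close>.\<close>
    define t where "t = max (f xhat + 1) ((r * fs - l \<bullet> (g xhat + d) - 1) / r)"
    have "r * fs \<le> l \<bullet> (g xhat + d) + r * t"
      by (rule key[OF xh(1)]) (auto simp: t_def)
    moreover have "r * t \<le> r * ((r * fs - l \<bullet> (g xhat + d) - 1) / r)"
      using r by (intro mult_left_mono_neg) (auto simp: t_def)
    ultimately show False using r by simp
  qed
  have l0: "0 \<le> l"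
    unfolding zero_le_vec_iff
  proof (intro allI, rule ccontr)
    fix j assume lj: "\<not> 0 \<le> l $ j"
    define c where "c = l \<bullet> (g xhat + d) + r * (f xhat + 1) - r * fs"
    \<comment> \<open>Raising component \<open>j\<close> by \<open>s\<close> stays in
      \<open>A\<close> and changes the functional by
      \<open>s * l $ j = - (\<bar>c\<bar> + 1)\<close>, enough to make it negative after adding
      \<open>c\<close>.\<close>
    define s where "s = (\<bar>c\<bar> + 1) / (- (l $ j))"
    have s: "0 \<le> s" unfolding s_def by (rule divide_nonneg_nonneg) (use lj in auto)
    have "r * fs \<le> l \<bullet> (g xhat + d + s *\<^sub>R axis j 1) + r * (f xhat + 1)"
      by (rule key[OF xh(1)]) (use s in \<open>auto simp: less_eq_vec_def axis_def\<close>)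
    then have "0 \<le> c + s * l $ j"
      by (simp add: c_def inner_add_right inner_axis)
    moreover have "s * l $ j = - (\<bar>c\<bar> + 1)"
      using lj by (simp add: s_def field_simps)
    ultimately show False by linarith
  qed
  \<comment> \<open>For \<open>r = 0\<close> the separation at the Slater point would bound the
    margin times \<open>norm l\<close> by 0, hence \<open>l = 0\<close> and the whole normal
    \<open>p\<close> would vanish.\<close>
  have "r \<noteq> 0"
  proof
    assume r: "r = 0"
    have "0 \<le> l \<bullet> (g xhat + d)"
      using key[OF xh(1) order_refl less_add_one] r by simp
    moreover have "slater_margin g d xhat * norm l \<le> - (l \<bullet> (g xhat + d))"
      by (rule slater_margin_norm_le[OF l0 sl])
    ultimately have "slater_margin g d xhat * norm l \<le> 0" by linarith
    then have "l = 0"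
      using slater_margin_pos[OF sl] by (simp add: mult_le_0_iff)
    then show False using p(1) lr r by (simp add: zero_prod_def)
  qed
  with r0 have r: "r > 0" by simp
  \<comment> \<open>\<open>key\<close> applies only to \<open>t\<close> strictly above
    \<open>f y\<close>; the value \<open>t = f y\<close> is reached by letting the slack tend to
    0.\<close>
  have weak: "fs \<le> f y + (l /\<^sub>R r) \<bullet> (g y + d)" if y: "y \<in> X" for y
  proof (rule field_le_epsilon)
    fix e :: real assume "e > 0"
    then have "r * fs \<le> l \<bullet> (g y + d) + r * (f y + e)"
      by (intro key[OF y]) auto
    then have "r * fs \<le> r * (f y + (l /\<^sub>R r) \<bullet> (g y + d) + e)"
      using r by (simp add: distrib_left mult.assoc[symmetric])
    then show "fs \<le> f y + (l /\<^sub>R r) \<bullet> (g y + d) + e" using r by simp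
  qed
  show thesis
  proof
    show "0 \<le> l /\<^sub>R r" using l0 r by (simp add: zero_le_vec_iff)
    show "opt_value X f g d \<le> dual_fun X f g (l /\<^sub>R r) d"
      unfolding dual_fun_def fs_def[symmetric]
      by (rule cINF_greatest) (use weak xh(1) in \<open>auto simp: lagrangian_def\<close>)
  qed
qed

section \<open>Vector-valued integrals and independence\<close>

lemma vec_integral_nth:
  fixes h :: "'a \<Rightarrow> real ^ 'm"
  assumes "integrable M h"
  shows "integrable M (\<lambda>\<omega>. h \<omega> $ j)" "integral\<^sup>L M (\<lambda>\<omega>. h \<omega> $ j) = integral\<^sup>L M h $ j"
  using integrable_inner_left[of "axis j 1" M h] integral_inner_left[of "axis j 1" M h] assms
  by (simp_all add: inner_axis)

context prob_space
begin

text \<open>Composition can only shrink the generated sigma-algebras. The function \<open>q\<close>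
  is assumed measurable on \<open>S\<close> alone, because it will be applied to \<open>g\<close>,
  which is Borel only on the set \<open>X\<close>.\<close>

lemma indep_rvs_compose:
  fixes U :: "'a \<Rightarrow> 'b::topological_space" and V :: "'a \<Rightarrow> 'c::topological_space"
    and p :: "'b \<Rightarrow> real" and q :: "'c \<Rightarrow> real"
  assumes indep: "indep_rvs M U V"
    and p: "p \<in> borel_measurable borel"
    and V: "\<And>\<omega>. \<omega> \<in> space M \<Longrightarrow> V \<omega> \<in> S"
    and q: "q \<in> borel_measurable (restrict_space borel S)"
  shows "indep_var borel (\<lambda>\<omega>. p (U \<omega>)) borel (\<lambda>\<omega>. q (V \<omega>))"
proof -
  have Um: "U \<in> borel_measurable M" and Vm: "V \<in> borel_measurable M"
    and ind: "indep_set (sigma_sets (space M) {U -` A \<inter> space M | A. A \<in> sets borel})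
      (sigma_sets (space M) {V -` A \<inter> space M | A. A \<in> sets borel})"
    using indep by (auto simp: indep_rvs_def)
  have "V \<in> measurable M (restrict_space borel S)"
    using Vm V by (intro measurable_restrict_space2) auto
  then have qV: "(\<lambda>\<omega>. q (V \<omega>)) \<in> borel_measurable M"
    using q by (rule measurable_compose)
  have pU: "(\<lambda>\<omega>. p (U \<omega>)) \<in> borel_measurable M"
    using Um p by (rule measurable_compose)
  have "{(\<lambda>\<omega>. p (U \<omega>)) -` A \<inter> space M | A. A \<in> sets borel}
      \<subseteq> {U -` A \<inter> space M | A. A \<in> sets borel}"
  proof safe
    fix A :: "real set" assume A: "A \<in> sets borel"
    have "p -` A \<in> sets borel" using measurable_sets[OF p A] by simp
    moreover have "(\<lambda>\<omega>. p (U \<omega>)) -` A \<inter> space M = U -` (p -` A) \<inter> space M" by auto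
    ultimately show "\<exists>B. (\<lambda>\<omega>. p (U \<omega>)) -` A \<inter> space M = U -` B \<inter> space M \<and> B \<in> sets borel"
      by blast
  qed
  moreover have "{(\<lambda>\<omega>. q (V \<omega>)) -` A \<inter> space M | A. A \<in> sets borel}
      \<subseteq> {V -` A \<inter> space M | A. A \<in> sets borel}"
  proof safe
    fix A :: "real set" assume A: "A \<in> sets borel"
    \<comment> \<open>The preimage under \<open>q\<close> is only the trace on \<open>S\<close> of a
      Borel set \<open>B\<close>. As \<open>V\<close> takes its values in \<open>S\<close>, pulling
      back \<open>B\<close> gives the same event.\<close>
    have "q -` A \<inter> S \<in> sets (restrict_space borel S)"
      using measurable_sets[OF q A] by (simp add: space_restrict_space)
    then obtain B where B: "B \<in> sets borel" "q -` A \<inter> S = S \<inter> B"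
      by (auto simp: sets_restrict_space)
    have "(\<lambda>\<omega>. q (V \<omega>)) -` A \<inter> space M = V -` B \<inter> space M"
      using B(2) V by blast
    then show "\<exists>B. (\<lambda>\<omega>. q (V \<omega>)) -` A \<inter> space M = V -` B \<inter> space M \<and> B \<in> sets borel"
      using B(1) by blast
  qed
  ultimately have "sigma_sets (space M) {(\<lambda>\<omega>. p (U \<omega>)) -` A \<inter> space M | A. A \<in> sets borel}
      \<subseteq> sigma_sets (space M) {U -` A \<inter> space M | A. A \<in> sets borel}"
    and "sigma_sets (space M) {(\<lambda>\<omega>. q (V \<omega>)) -` A \<inter> space M | A. A \<in> sets borel}
      \<subseteq> sigma_sets (space M) {V -` A \<inter> space M | A. A \<in> sets borel}"
    by - (erule sigma_sets_mono')+
  then show ?thesis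
    using ind pU qV unfolding indep_var_eq indep_sets2_eq by (meson subset_eq)
qed

text \<open>Componentwise, the expectation of the product factors by independence, and the centered
  factor has mean 0. This eliminates the terms linear in the noise from the drift.\<close>

lemma indep_rvs_centered_inner:
  fixes U :: "'a \<Rightarrow> real ^ 'm" and V :: "'a \<Rightarrow> 'c::topological_space" and q :: "'c \<Rightarrow> real ^ 'm"
  assumes indep: "indep_rvs M U V"
    and U: "integrable M U" "integral\<^sup>L M U = d"
    and V: "\<And>\<omega>. \<omega> \<in> space M \<Longrightarrow> V \<omega> \<in> S"
    and q: "q \<in> borel_measurable (restrict_space borel S)"
    and qV: "integrable M (\<lambda>\<omega>. q (V \<omega>))"
  shows "integrable M (\<lambda>\<omega>. q (V \<omega>) \<bullet> (U \<omega> - d))"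
    and "integral\<^sup>L M (\<lambda>\<omega>. q (V \<omega>) \<bullet> (U \<omega> - d)) = 0"
proof -
  note comp = vec_integral_nth(1)
  have mean: "integral\<^sup>L M (\<lambda>\<omega>. U \<omega> $ j) = d $ j" for j
    using vec_integral_nth(2)[OF U(1)] U(2) by simp
  have iv: "indep_var borel (\<lambda>\<omega>. U \<omega> $ j - d $ j) borel (\<lambda>\<omega>. q (V \<omega>) $ j)" for j
  proof (rule indep_rvs_compose[OF indep _ V])
    have nth: "(\<lambda>u :: real ^ 'm. u $ j) \<in> borel_measurable borel"
      by (intro borel_measurable_continuous_onI continuous_intros)
    then show "(\<lambda>u :: real ^ 'm. u $ j - d $ j) \<in> borel_measurable borel"
      by simp
    show "(\<lambda>y. q y $ j) \<in> borel_measurable (restrict_space borel S)"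
      using measurable_compose[OF q nth] .
  qed
  have int1: "integrable M (\<lambda>\<omega>. U \<omega> $ j - d $ j)" for j
    using comp[OF U(1)] by simp
  have prod: "integrable M (\<lambda>\<omega>. (U \<omega> $ j - d $ j) * q (V \<omega>) $ j)"
    "integral\<^sup>L M (\<lambda>\<omega>. (U \<omega> $ j - d $ j) * q (V \<omega>) $ j) = 0" for j
    using indep_var_integrable[OF iv int1 comp[OF qV]]
      indep_var_lebesgue_integral[OF iv int1 comp[OF qV]] comp[OF U(1)] mean
    by (simp_all add: prob_space)
  have eq: "q (V \<omega>) \<bullet> (U \<omega> - d) = (\<Sum>j\<in>UNIV. (U \<omega> $ j - d $ j) * q (V \<omega>) $ j)" for \<omega>
    by (simp add: inner_vec_def mult.commute)
  show "integrable M (\<lambda>\<omega>. q (V \<omega>) \<bullet> (U \<omega> - d))"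
    unfolding eq using prod by simp
  show "integral\<^sup>L M (\<lambda>\<omega>. q (V \<omega>) \<bullet> (U \<omega> - d)) = 0"
    unfolding eq using prod by simp
qed

end

section \<open>Second moments, Jensen inequalities and averages\<close>

lemma norm_sq_add:
  fixes a b :: "'a::real_inner"
  shows "(norm (a + b))\<^sup>2 = (norm a)\<^sup>2 + 2 * (a \<bullet> b) + (norm b)\<^sup>2"
  by (simp add: power2_norm_eq_inner inner_add_left inner_add_right inner_commute)

lemma norm_sq_add_le:
  fixes a b :: "'a::real_inner"
  shows "(norm (a + b))\<^sup>2 \<le> 2 * (norm a)\<^sup>2 + 2 * (norm b)\<^sup>2"
proof -
  have "2 * (a \<bullet> b) \<le> (norm a)\<^sup>2 + (norm b)\<^sup>2"
    using zero_le_power2[of "norm (a - b)"]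
    by (simp add: power2_norm_eq_inner inner_diff_left inner_diff_right inner_commute)
  then show ?thesis unfolding norm_sq_add by linarith
qed

lemma vec_integral_mono:
  fixes h k :: "'a \<Rightarrow> real ^ 'm"
  assumes "integrable M h" "integrable M k" "\<And>\<omega>. \<omega> \<in> space M \<Longrightarrow> h \<omega> \<le> k \<omega>"
  shows "integral\<^sup>L M h \<le> integral\<^sup>L M k"
  unfolding less_eq_vec_def
proof
  fix j
  have "integral\<^sup>L M (\<lambda>\<omega>. h \<omega> $ j) \<le> integral\<^sup>L M (\<lambda>\<omega>. k \<omega> $ j)"
    using assms by (intro integral_mono) (auto simp: vec_integral_nth less_eq_vec_def)
  then show "integral\<^sup>L M h $ j \<le> integral\<^sup>L M k $ j"
    using assms by (simp add: vec_integral_nth)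
qed

lemma (in prob_space) integrable_of_square:
  fixes h :: "'a \<Rightarrow> 'b::euclidean_space"
  assumes "h \<in> borel_measurable M" "integrable M (\<lambda>\<omega>. (norm (h \<omega>))\<^sup>2)"
  shows "integrable M h"
  using square_integrable_imp_integrable[of "\<lambda>\<omega>. norm (h \<omega>)"] assms
  by (simp add: integrable_norm_iff)

text \<open>The difference of the two sides is the variance of \<open>Z\<close>, which is
  nonnegative.\<close>

lemma (in prob_space) norm_expectation_sq_le:
  fixes Z :: "'a \<Rightarrow> 'b::euclidean_space"
  assumes "integrable M Z" "integrable M (\<lambda>\<omega>. (norm (Z \<omega>))\<^sup>2)"
  shows "(norm (integral\<^sup>L M Z))\<^sup>2 \<le> integral\<^sup>L M (\<lambda>\<omega>. (norm (Z \<omega>))\<^sup>2)"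
proof -
  let ?m = "integral\<^sup>L M Z"
  have "(norm (Z \<omega> - ?m))\<^sup>2 = (norm (Z \<omega>))\<^sup>2 - 2 * (Z \<omega> \<bullet> ?m) + (norm ?m)\<^sup>2" for \<omega>
    using norm_sq_add[of "Z \<omega>" "- ?m"] by simp
  then have "integral\<^sup>L M (\<lambda>\<omega>. (norm (Z \<omega> - ?m))\<^sup>2)
      = integral\<^sup>L M (\<lambda>\<omega>. (norm (Z \<omega>))\<^sup>2) - 2 * (?m \<bullet> ?m) + (norm ?m)\<^sup>2"
    using assms by (simp add: prob_space)
  moreover have "0 \<le> integral\<^sup>L M (\<lambda>\<omega>. (norm (Z \<omega> - ?m))\<^sup>2)"
    by (rule integral_nonneg_AE) simp
  ultimately show ?thesis by (simp add: power2_norm_eq_inner)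
qed

lemma convex_on_running_avg:
  assumes "convex_on C h" "k \<ge> 1" "\<And>i. i \<in> {1..k} \<Longrightarrow> u i \<in> C"
  shows "h (running_avg u k) \<le> running_avg (\<lambda>i. h (u i)) k"
  using convex_on_sum[OF _ _ assms(1), of "{1..k}" "\<lambda>_. 1 / real k" u] assms(2,3)
  by (simp add: running_avg_def scaleR_sum_right sum_distrib_left)

lemma running_avg_in_convex:
  assumes "convex C" "k \<ge> 1" "\<And>i. i \<in> {1..k} \<Longrightarrow> u i \<in> C"
  shows "running_avg u k \<in> C"
  using convex_sum[of "{1..k}" C "\<lambda>_. 1 / real k" u] assms
  by (simp add: running_avg_def scaleR_sum_right)

section \<open>The stochastic dual update\<close>

locale dual_update = prob_space M
  for M :: "'w measure" +
  fixes X :: "(real ^ 'n) set"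
    and f :: "real ^ 'n \<Rightarrow> real"
    and g :: "real ^ 'n \<Rightarrow> real ^ 'm"
    and d :: "real ^ 'm"
    and D :: "nat \<Rightarrow> 'w \<Rightarrow> real ^ 'm"
    and x :: "nat \<Rightarrow> 'w \<Rightarrow> real ^ 'n"
    and lam :: "nat \<Rightarrow> 'w \<Rightarrow> real ^ 'm"
    and e :: "nat \<Rightarrow> real ^ 'm"
    and lam1 :: "real ^ 'm"
    and a s sd :: real
  assumes cX: "convex X"
    and cf: "convex_on X f" and cg: "\<And>j. convex_on X (\<lambda>y. g y $ j)"
    and fm: "f \<in> borel_measurable (restrict_space borel X)"
    and gm: "g \<in> borel_measurable (restrict_space borel X)"
    and g_bound: "\<And>y. y \<in> X \<Longrightarrow> norm (g y + d) \<le> s"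
    and D_int: "\<And>k. k \<ge> 1 \<Longrightarrow> integrable M (D k)"
    and D_mean: "\<And>k. k \<ge> 1 \<Longrightarrow> integral\<^sup>L M (D k) = d"
    and D_sq: "\<And>k. k \<ge> 1 \<Longrightarrow> integrable M (\<lambda>\<omega>. (norm (D k \<omega> - d))\<^sup>2)"
    and D_var: "\<And>k. k \<ge> 1 \<Longrightarrow> integral\<^sup>L M (\<lambda>\<omega>. (norm (D k \<omega> - d))\<^sup>2) = sd\<^sup>2"
    and indep_lam: "\<And>k. k \<ge> 1 \<Longrightarrow> indep_rvs M (D k) (lam k)"
    and indep_x: "\<And>k. k \<ge> 1 \<Longrightarrow> indep_rvs M (D k) (x k)"
    and a_pos: "a > 0"
    and lam1_nonneg: "0 \<le> lam1"
    and lam_1: "\<And>\<omega>. \<omega> \<in> space M \<Longrightarrow> lam 1 \<omega> = lam1"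
    and mu_nonneg: "\<And>k \<omega>. k \<ge> 1 \<Longrightarrow> \<omega> \<in> space M \<Longrightarrow> 0 \<le> lam k \<omega> + e k"
    and x_min: "\<And>k \<omega>. k \<ge> 1 \<Longrightarrow> \<omega> \<in> space M \<Longrightarrow>
           is_arg_min (\<lambda>y. lagrangian f g y (lam k \<omega> + e k) (D k \<omega>)) (\<lambda>y. y \<in> X) (x k \<omega>)"
    and lam_Suc: "\<And>k \<omega>. k \<ge> 1 \<Longrightarrow> \<omega> \<in> space M \<Longrightarrow>
           lam (Suc k) \<omega> = pos_part (lam k \<omega> + a *\<^sub>R (g (x k \<omega>) + D k \<omega>))"
begin

text \<open>The constraint value is taken with the mean perturbation \<open>d\<close>, not with the
  realization \<open>D k\<close>; the difference \<open>D k - d\<close> is handled separately as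
  centered noise.\<close>

abbreviation "G k \<omega> \<equiv> g (x k \<omega>) + d"

lemma x_in: "k \<ge> 1 \<Longrightarrow> \<omega> \<in> space M \<Longrightarrow> x k \<omega> \<in> X"
  using x_min by (auto simp: is_arg_min_def)

text \<open>The minimizers do not depend on the noise, which only shifts the Lagrangian by a constant.\<close>

lemma x_le:
  assumes "k \<ge> 1" "\<omega> \<in> space M" "y \<in> X"
  shows "f (x k \<omega>) + (lam k \<omega> + e k) \<bullet> G k \<omega> \<le> f y + (lam k \<omega> + e k) \<bullet> (g y + d)"
proof -
  have "\<not> lagrangian f g y (lam k \<omega> + e k) (D k \<omega>)
      < lagrangian f g (x k \<omega>) (lam k \<omega> + e k) (D k \<omega>)"
    using x_min[OF assms(1,2)] assms(3) by (auto simp: is_arg_min_def)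
  then show ?thesis by (simp add: lagrangian_def inner_add_right)
qed

lemma lam_nonneg: "k \<ge> 1 \<Longrightarrow> \<omega> \<in> space M \<Longrightarrow> 0 \<le> lam k \<omega>"
proof (cases k)
  case (Suc i)
  assume *: "k \<ge> 1" "\<omega> \<in> space M"
  show ?thesis
  proof (cases "i = 0")
    case True then show ?thesis using Suc * lam_1 lam1_nonneg by simp
  next
    case False then show ?thesis using Suc * lam_Suc[of i \<omega>] pos_part_nonneg by simp
  qed
qed simp

lemma X_ne: "X \<noteq> {}"
  using not_empty x_in[of 1] by blast

lemma s_nonneg: "0 \<le> s"
  using X_ne g_bound norm_ge_zero order_trans by blast

lemma abs_inner_g_le:
  assumes "y \<in> X"
  shows "\<bar>v \<bullet> (g y + d)\<bar> \<le> norm v * s"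
  using Cauchy_Schwarz_ineq2[of v "g y + d"] mult_left_mono[OF g_bound[OF assms] norm_ge_zero[of v]]
  by linarith

text \<open>The first Lagrangian attains its minimum over \<open>X\<close> at \<open>x 1\<close>.
  Its linear part is at most \<open>norm ?m * s\<close> in absolute value, both at
  \<open>x 1\<close> and at \<open>y\<close>, so \<open>f\<close> cannot drop below
  \<open>f (x 1 \<omega>)\<close> by more than twice that.\<close>

lemma f_lower: obtains c where "\<And>y. y \<in> X \<Longrightarrow> c \<le> f y"
proof -
  obtain \<omega> where w: "\<omega> \<in> space M" using not_empty by blast
  let ?m = "lam 1 \<omega> + e 1"
  have "f (x 1 \<omega>) - 2 * (norm ?m * s) \<le> f y" if "y \<in> X" for y
    using x_le[of 1 \<omega> y] w that abs_inner_g_le[OF that, of ?m] abs_inner_g_le[OF x_in[of 1 \<omega>], of ?m]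
    by linarith
  then show thesis using that by blast
qed

lemma bdd_f: "bdd_below (f ` X)"
  using f_lower by (meson bdd_belowI2)

lemma bdd_lagrangian: "bdd_below ((\<lambda>y. lagrangian f g y l d) ` X)"
proof -
  obtain c where c: "\<And>y. y \<in> X \<Longrightarrow> c \<le> f y" using f_lower by blast
  have "c - norm l * s \<le> lagrangian f g y l d" if "y \<in> X" for y
    using c[OF that] abs_inner_g_le[OF that, of l] by (simp add: lagrangian_def)
  then show ?thesis by (meson bdd_belowI2)
qed

section \<open>Measurability and integrability of the iterates\<close>

lemma meas:
  assumes "k \<ge> 1"
  shows "lam k \<in> borel_measurable M" "x k \<in> measurable M (restrict_space borel X)"
    "D k \<in> borel_measurable M"
  \<comment> \<open>\<open>indep_rvs\<close> includes the Borel measurability of both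
    variables.\<close>
  using indep_lam[OF assms] indep_x[OF assms] x_in[OF assms]
  by (auto simp: indep_rvs_def intro!: measurable_restrict_space2)

lemma gx_meas: "k \<ge> 1 \<Longrightarrow> (\<lambda>\<omega>. g (x k \<omega>)) \<in> borel_measurable M"
  using measurable_compose[OF meas(2) gm] .

lemma fx_meas: "k \<ge> 1 \<Longrightarrow> (\<lambda>\<omega>. f (x k \<omega>)) \<in> borel_measurable M"
  using measurable_compose[OF meas(2) fm] .

lemma G_int: "k \<ge> 1 \<Longrightarrow> integrable M (G k)"
  by (rule integrable_const_bound[of _ s])
    (use g_bound x_in gx_meas in \<open>auto intro!: AE_I2\<close>)

lemma G_sq:
  assumes "k \<ge> 1"
  shows "integrable M (\<lambda>\<omega>. (norm (G k \<omega>))\<^sup>2)" "integral\<^sup>L M (\<lambda>\<omega>. (norm (G k \<omega>))\<^sup>2) \<le> s\<^sup>2"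
proof -
  have b: "(norm (G k \<omega>))\<^sup>2 \<le> s\<^sup>2" if "\<omega> \<in> space M" for \<omega>
    using g_bound[OF x_in[OF assms that]] by (simp add: power_mono)
  show i: "integrable M (\<lambda>\<omega>. (norm (G k \<omega>))\<^sup>2)"
    by (rule integrable_const_bound[of _ "s\<^sup>2"])
      (use b gx_meas[OF assms] in \<open>auto intro!: AE_I2\<close>)
  have "integral\<^sup>L M (\<lambda>\<omega>. (norm (G k \<omega>))\<^sup>2) \<le> integral\<^sup>L M (\<lambda>\<omega>. s\<^sup>2)"
    by (rule integral_mono[OF i]) (use b in auto)
  then show "integral\<^sup>L M (\<lambda>\<omega>. (norm (G k \<omega>))\<^sup>2) \<le> s\<^sup>2" by (simp add: prob_space)
qed

text \<open>Square integrability passes through the update: the start is constant, and each step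
  adds a bounded constraint value and noise of finite variance.\<close>

lemma lam_sq:
  assumes "k \<ge> 1" shows "integrable M (\<lambda>\<omega>. (norm (lam k \<omega>))\<^sup>2)"
  using assms
proof (induction k rule: dec_induct)
  case base
  have "integrable M (\<lambda>\<omega>. (norm lam1)\<^sup>2)" by simp
  then show ?case
    by (rule Bochner_Integration.integrable_cong[THEN iffD1, rotated -1]) (use lam_1 in auto)
next
  case (step k)
  let ?h = "\<lambda>\<omega>. 2 * (norm (lam k \<omega>))\<^sup>2
    + 2 * a\<^sup>2 * (2 * (norm (G k \<omega>))\<^sup>2 + 2 * (norm (D k \<omega> - d))\<^sup>2)"
  have "integrable M ?h"
    using step D_sq G_sq by (intro Bochner_Integration.integrable_add integrable_mult_right) auto
  then show ?case
  proof (rule Bochner_Integration.integrable_bound)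
    show "(\<lambda>\<omega>. (norm (lam (Suc k) \<omega>))\<^sup>2) \<in> borel_measurable M"
      using meas(1)[of "Suc k"] by simp
    have "(norm (lam (Suc k) \<omega>))\<^sup>2 \<le> ?h \<omega>" if w: "\<omega> \<in> space M" for \<omega>
    proof -
      \<comment> \<open>Nonexpansiveness with target 0, after splitting
        \<open>g (x k \<omega>) + D k \<omega>\<close> into \<open>G k \<omega>\<close> and centered
        noise.\<close>
      have "norm (lam (Suc k) \<omega>) \<le> norm (lam k \<omega> + a *\<^sub>R (G k \<omega> + (D k \<omega> - d)))"
        using norm_pos_part_diff_le[of 0 "lam k \<omega> + a *\<^sub>R (g (x k \<omega>) + D k \<omega>)"] lam_Suc step(1) w
        by simp
      then have "(norm (lam (Suc k) \<omega>))\<^sup>2 \<le> (norm (lam k \<omega> + a *\<^sub>R (G k \<omega> + (D k \<omega> - d))))\<^sup>2"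
        by (simp add: power_mono)
      also have "\<dots> \<le> 2 * (norm (lam k \<omega>))\<^sup>2 + 2 * (norm (a *\<^sub>R (G k \<omega> + (D k \<omega> - d))))\<^sup>2"
        by (rule norm_sq_add_le)
      also have "\<dots> = 2 * (norm (lam k \<omega>))\<^sup>2 + 2 * a\<^sup>2 * (norm (G k \<omega> + (D k \<omega> - d)))\<^sup>2"
        by (simp add: power_mult_distrib)
      also have "\<dots> \<le> ?h \<omega>"
        by (intro add_left_mono mult_left_mono norm_sq_add_le) auto
      finally show ?thesis .
    qed
    then show "AE \<omega> in M. norm ((norm (lam (Suc k) \<omega>))\<^sup>2) \<le> norm (?h \<omega>)"
      by (intro AE_I2) fastforce
  qed
qed

lemma lam_int: "k \<ge> 1 \<Longrightarrow> integrable M (lam k)"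
  using integrable_of_square[OF meas(1) lam_sq] .

lemma lam_diff_sq:
  assumes "k \<ge> 1" shows "integrable M (\<lambda>\<omega>. (norm (lam k \<omega> - v))\<^sup>2)"
proof -
  have "(\<lambda>\<omega>. (norm (lam k \<omega> - v))\<^sup>2) =
      (\<lambda>\<omega>. (norm (lam k \<omega>))\<^sup>2 + 2 * (lam k \<omega> \<bullet> (- v)) + (norm v)\<^sup>2)"
    using norm_sq_add[of _ "- v"] by (intro ext) simp
  then show ?thesis using lam_sq[OF assms] lam_int[OF assms] by simp
qed

lemma lam_G_int:
  assumes "k \<ge> 1" shows "integrable M (\<lambda>\<omega>. (lam k \<omega> - v) \<bullet> G k \<omega>)"
proof (rule Bochner_Integration.integrable_bound)
  show "integrable M (\<lambda>\<omega>. norm (lam k \<omega> - v) * s)" using lam_int[OF assms] by simp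
  show "(\<lambda>\<omega>. (lam k \<omega> - v) \<bullet> G k \<omega>) \<in> borel_measurable M"
    using meas(1)[OF assms] gx_meas[OF assms] by simp
  show "AE \<omega> in M. norm ((lam k \<omega> - v) \<bullet> G k \<omega>) \<le> norm (norm (lam k \<omega> - v) * s)"
    using abs_inner_g_le[OF x_in[OF assms]] s_nonneg by (auto intro!: AE_I2)
qed

section \<open>The expected drift of the dual iterates\<close>

lemma lam_dist_step:
  assumes k: "k \<ge> 1" and v: "0 \<le> v"
  shows "integral\<^sup>L M (\<lambda>\<omega>. (norm (lam (Suc k) \<omega> - v))\<^sup>2)
    \<le> integral\<^sup>L M (\<lambda>\<omega>. (norm (lam k \<omega> - v))\<^sup>2)
      + 2 * a * integral\<^sup>L M (\<lambda>\<omega>. (lam k \<omega> - v) \<bullet> G k \<omega>) + a\<^sup>2 * (s\<^sup>2 + sd\<^sup>2)"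
proof -
  let ?N = "\<lambda>\<omega>. D k \<omega> - d"
  \<comment> \<open>Of the two terms linear in the noise, this one vanishes because
    \<open>D k\<close> is independent of \<open>lam k\<close>.\<close>
  have n1: "integrable M (\<lambda>\<omega>. (lam k \<omega> - v) \<bullet> ?N \<omega>)"
    "integral\<^sup>L M (\<lambda>\<omega>. (lam k \<omega> - v) \<bullet> ?N \<omega>) = 0"
    using indep_rvs_centered_inner[OF indep_lam[OF k] D_int[OF k] D_mean[OF k],
        of UNIV "\<lambda>l. l - v"] lam_int[OF k]
    by simp_all
  \<comment> \<open>The other one comes from the square of the increment and vanishes because
    \<open>D k\<close> is independent of \<open>x k\<close>.\<close>
  have n2: "integrable M (\<lambda>\<omega>. G k \<omega> \<bullet> ?N \<omega>)" "integral\<^sup>L M (\<lambda>\<omega>. G k \<omega> \<bullet> ?N \<omega>) = 0"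
    using indep_rvs_centered_inner[OF indep_x[OF k] D_int[OF k] D_mean[OF k] x_in[OF k],
        of "\<lambda>y. g y + d"] G_int[OF k] gm
    by simp_all
  let ?h = "\<lambda>\<omega>. (norm (lam k \<omega> - v))\<^sup>2 + 2 * a * ((lam k \<omega> - v) \<bullet> G k \<omega>)
    + 2 * a * ((lam k \<omega> - v) \<bullet> ?N \<omega>)
    + a\<^sup>2 * ((norm (G k \<omega>))\<^sup>2 + 2 * (G k \<omega> \<bullet> ?N \<omega>) + (norm (?N \<omega>))\<^sup>2)"
  \<comment> \<open>The projection fixes \<open>v\<close>, so dropping it can only increase the
    distance; \<open>?h\<close> is the exact expansion of the square that remains.\<close>
  have "(norm (lam (Suc k) \<omega> - v))\<^sup>2 \<le> ?h \<omega>" if w: "\<omega> \<in> space M" for \<omega>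
  proof -
    have "norm (lam (Suc k) \<omega> - v) \<le> norm (lam k \<omega> + a *\<^sub>R (g (x k \<omega>) + D k \<omega>) - v)"
      using norm_pos_part_diff_le[OF v] lam_Suc[OF k w] by simp
    also have "lam k \<omega> + a *\<^sub>R (g (x k \<omega>) + D k \<omega>) - v
        = (lam k \<omega> - v) + a *\<^sub>R (G k \<omega> + ?N \<omega>)" by simp
    finally have "(norm (lam (Suc k) \<omega> - v))\<^sup>2 \<le> (norm ((lam k \<omega> - v) + a *\<^sub>R (G k \<omega> + ?N \<omega>)))\<^sup>2"
      by (simp add: power_mono)
    also have "\<dots> = (norm (lam k \<omega> - v))\<^sup>2 + 2 * a * ((lam k \<omega> - v) \<bullet> (G k \<omega> + ?N \<omega>))
        + a\<^sup>2 * (norm (G k \<omega> + ?N \<omega>))\<^sup>2"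
      unfolding norm_sq_add[of "lam k \<omega> - v"] by (simp add: power_mult_distrib)
    also have "\<dots> = ?h \<omega>"
      unfolding norm_sq_add[of "G k \<omega>"] inner_add_right[of _ "G k \<omega>"] by (simp add: distrib_left)
    finally show ?thesis .
  qed
  moreover have int_h: "integrable M ?h"
    using lam_diff_sq[OF k] lam_G_int[OF k] n1(1) n2(1) G_sq(1)[OF k] D_sq[OF k]
    by (intro Bochner_Integration.integrable_add integrable_mult_right) auto
  ultimately have "integral\<^sup>L M (\<lambda>\<omega>. (norm (lam (Suc k) \<omega> - v))\<^sup>2) \<le> integral\<^sup>L M ?h"
    using lam_diff_sq[of "Suc k"] by (intro integral_mono) auto
  also have "\<dots> = integral\<^sup>L M (\<lambda>\<omega>. (norm (lam k \<omega> - v))\<^sup>2)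
      + 2 * a * integral\<^sup>L M (\<lambda>\<omega>. (lam k \<omega> - v) \<bullet> G k \<omega>)
      + a\<^sup>2 * (integral\<^sup>L M (\<lambda>\<omega>. (norm (G k \<omega>))\<^sup>2) + sd\<^sup>2)"
  proof -
    note [simp] = lam_diff_sq[OF k] lam_G_int[OF k] n1 n2 G_sq(1)[OF k] D_sq[OF k] D_var[OF k]
    show ?thesis by simp
  qed
  also have "\<dots> \<le> integral\<^sup>L M (\<lambda>\<omega>. (norm (lam k \<omega> - v))\<^sup>2)
      + 2 * a * integral\<^sup>L M (\<lambda>\<omega>. (lam k \<omega> - v) \<bullet> G k \<omega>) + a\<^sup>2 * (s\<^sup>2 + sd\<^sup>2)"
    using G_sq(2)[OF k] by (intro add_left_mono mult_left_mono add_right_mono) auto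
  finally show ?thesis .
qed

text \<open>The one-step bounds telescope. The index is shifted so that \<open>k = 0\<close> is the
  deterministic start \<open>lam 1\<close> and \<open>k\<close> steps end at
  \<open>lam (Suc k)\<close>.\<close>

lemma lam_dist_sum:
  assumes v: "0 \<le> v"
  shows "integral\<^sup>L M (\<lambda>\<omega>. (norm (lam (Suc k) \<omega> - v))\<^sup>2)
    \<le> (norm (lam1 - v))\<^sup>2 + 2 * a * (\<Sum>i=1..k. integral\<^sup>L M (\<lambda>\<omega>. (lam i \<omega> - v) \<bullet> G i \<omega>))
      + a\<^sup>2 * (s\<^sup>2 + sd\<^sup>2) * real k"
proof (induction k)
  case 0
  have "integral\<^sup>L M (\<lambda>\<omega>. (norm (lam (Suc 0) \<omega> - v))\<^sup>2) = integral\<^sup>L M (\<lambda>\<omega>. (norm (lam1 - v))\<^sup>2)"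
    by (rule Bochner_Integration.integral_cong) (use lam_1 in auto)
  then show ?case by (simp add: prob_space)
next
  case (Suc k)
  show ?case using lam_dist_step[of "Suc k", OF _ v] Suc by (simp add: algebra_simps)
qed

section \<open>Averaged iterates\<close>

abbreviation "xbar k \<omega> \<equiv> running_avg (\<lambda>i. x i \<omega>) k"
abbreviation "lbar k \<omega> \<equiv> running_avg (\<lambda>i. lam i \<omega>) k"

lemma xbar_in: "k \<ge> 1 \<Longrightarrow> \<omega> \<in> space M \<Longrightarrow> xbar k \<omega> \<in> X"
  using running_avg_in_convex[OF cX] x_in by simp

lemma xbar_meas:
  assumes "k \<ge> 1" shows "xbar k \<in> measurable M (restrict_space borel X)"
proof (rule measurable_restrict_space2)
  have "x i \<in> borel_measurable M" if "i \<in> {1..k}" for i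
    using indep_x[of i] that by (simp add: indep_rvs_def)
  then show "xbar k \<in> borel_measurable M"
    unfolding running_avg_def by (intro borel_measurable_scaleR borel_measurable_sum) auto
qed (use xbar_in[OF assms] in auto)

lemma expectation_lbar:
  "integral\<^sup>L M (lbar k) = (1 / real k) *\<^sub>R (\<Sum>i=1..k. integral\<^sup>L M (lam i))"
  unfolding running_avg_def using lam_int by (simp add: Bochner_Integration.integral_sum)

text \<open>No upper bound on \<open>f\<close> is available. Comparing \<open>x k\<close> with a
  fixed \<open>y\<close> bounds \<open>f (x k \<omega>)\<close> by an affine function of
  \<open>norm (lam k \<omega> + e k)\<close>, which is integrable.\<close>

lemma fx_int: assumes "k \<ge> 1" shows "integrable M (\<lambda>\<omega>. f (x k \<omega>))"
proof -
  obtain c where c: "\<And>y. y \<in> X \<Longrightarrow> c \<le> f y" using f_lower by blast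
  obtain y where y: "y \<in> X" using X_ne by blast
  have b: "\<bar>f (x k \<omega>)\<bar> \<le> \<bar>c\<bar> + \<bar>f y\<bar> + 2 * norm (lam k \<omega> + e k) * s" if w: "\<omega> \<in> space M" for \<omega>
    using x_le[OF assms w y] c[OF x_in[OF assms w]]
      abs_inner_g_le[OF y, of "lam k \<omega> + e k"] abs_inner_g_le[OF x_in[OF assms w], of "lam k \<omega> + e k"]
    by linarith
  show ?thesis
  proof (rule Bochner_Integration.integrable_bound)
    show "integrable M (\<lambda>\<omega>. \<bar>c\<bar> + \<bar>f y\<bar> + 2 * norm (lam k \<omega> + e k) * s)"
      using lam_int[OF assms] by simp
    show "(\<lambda>\<omega>. f (x k \<omega>)) \<in> borel_measurable M" by (rule fx_meas[OF assms])
    show "AE \<omega> in M. norm (f (x k \<omega>)) \<le> norm (\<bar>c\<bar> + \<bar>f y\<bar> + 2 * norm (lam k \<omega> + e k) * s)"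
      using b by (intro AE_I2) fastforce
  qed
qed

lemma f_xbar_le:
  "k \<ge> 1 \<Longrightarrow> \<omega> \<in> space M \<Longrightarrow> f (xbar k \<omega>) \<le> (\<Sum>i=1..k. f (x i \<omega>)) / real k"
  using convex_on_running_avg[OF cf, of k "\<lambda>i. x i \<omega>"] x_in
  by (simp add: running_avg_def[of "\<lambda>i. f (x i \<omega>)"])

text \<open>By convexity the value lies between a lower bound of \<open>f\<close> and the average of
  the integrable \<open>f (x i \<omega>)\<close>.\<close>

lemma f_xbar_int: assumes "k \<ge> 1" shows "integrable M (\<lambda>\<omega>. f (xbar k \<omega>))"
proof -
  obtain c where c: "\<And>y. y \<in> X \<Longrightarrow> c \<le> f y" using f_lower by blast
  show ?thesis
  proof (rule Bochner_Integration.integrable_bound)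
    show "integrable M (\<lambda>\<omega>. \<bar>c\<bar> + \<bar>(\<Sum>i=1..k. f (x i \<omega>)) / real k\<bar>)"
      using fx_int by (intro Bochner_Integration.integrable_add integrable_abs
          integrable_divide Bochner_Integration.integrable_sum) auto
    show "(\<lambda>\<omega>. f (xbar k \<omega>)) \<in> borel_measurable M"
      using measurable_compose[OF xbar_meas[OF assms] fm] .
    have "\<bar>f (xbar k \<omega>)\<bar> \<le> \<bar>c\<bar> + \<bar>(\<Sum>i=1..k. f (x i \<omega>)) / real k\<bar>" if "\<omega> \<in> space M" for \<omega>
      using f_xbar_le[OF assms that] c[OF xbar_in[OF assms that]] by linarith
    then show "AE \<omega> in M. norm (f (xbar k \<omega>)) \<le> norm (\<bar>c\<bar> + \<bar>(\<Sum>i=1..k. f (x i \<omega>)) / real k\<bar>)"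
      by (intro AE_I2) fastforce
  qed
qed

lemma g_xbar_int: assumes "k \<ge> 1" shows "integrable M (\<lambda>\<omega>. g (xbar k \<omega>) + d)"
proof (rule integrable_const_bound[of _ s])
  show "(\<lambda>\<omega>. g (xbar k \<omega>) + d) \<in> borel_measurable M"
    using measurable_compose[OF xbar_meas[OF assms] gm] by simp
qed (use g_bound xbar_in[OF assms] in \<open>auto intro!: AE_I2\<close>)

lemma g_xbar_le:
  assumes "k \<ge> 1" "\<omega> \<in> space M"
  shows "g (xbar k \<omega>) + d \<le> (1 / real k) *\<^sub>R (\<Sum>i=1..k. G i \<omega>)"
  unfolding less_eq_vec_def
proof
  fix j
  have "g (xbar k \<omega>) $ j \<le> running_avg (\<lambda>i. g (x i \<omega>) $ j) k"
    using convex_on_running_avg[OF cg assms(1)] x_in assms(2) by simp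
  moreover have "((1 / real k) *\<^sub>R (\<Sum>i=1..k. G i \<omega>)) $ j
      = (1 / real k) * (\<Sum>i=1..k. g (x i \<omega>) $ j + d $ j)"
    by (simp only: vector_scaleR_component sum_component vector_add_component real_scaleR_def)
  ultimately show "(g (xbar k \<omega>) + d) $ j \<le> ((1 / real k) *\<^sub>R (\<Sum>i=1..k. G i \<omega>)) $ j"
    using assms(1)
    by (simp add: running_avg_def[of "\<lambda>i. g (x i \<omega>) $ j"] sum.distrib add_divide_distrib)
qed

section \<open>The upper bound on the objective\<close>

lemma expectation_f_xbar_le:
  assumes k: "k \<ge> 1" and feas: "feasible_set X g d \<noteq> {}"
  shows "integral\<^sup>L M (\<lambda>\<omega>. f (xbar k \<omega>) - opt_value X f g d)
    \<le> a * (s\<^sup>2 + sd\<^sup>2) / 2 + (norm lam1)\<^sup>2 / (2 * a * real k) + (\<Sum>i=1..k. norm (e i) * s) / real k"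
proof -
  let ?fs = "opt_value X f g d"
  let ?I = "\<lambda>i. integral\<^sup>L M (\<lambda>\<omega>. lam i \<omega> \<bullet> G i \<omega>)"
  have pt: "f (x i \<omega>) \<le> ?fs - lam i \<omega> \<bullet> G i \<omega> + norm (e i) * s"
    if i: "i \<ge> 1" and w: "\<omega> \<in> space M" for i \<omega>
  proof -
    \<comment> \<open>At a feasible \<open>y\<close> the nonnegative multiplier
      \<open>lam i \<omega> + e i\<close> contributes a nonpositive term, so the minimal Lagrangian
      value is at most \<open>f y\<close>.\<close>
    have "f (x i \<omega>) + (lam i \<omega> + e i) \<bullet> G i \<omega> \<le> ?fs"
      unfolding opt_value_def
    proof (rule cINF_greatest[OF feas])
      fix y assume "y \<in> feasible_set X g d"
      then have y: "y \<in> X" "g y + d \<le> 0" by (auto simp: feasible_set_def)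
      have "(lam i \<omega> + e i) \<bullet> (g y + d) \<le> 0"
        using inner_vec_mono[OF mu_nonneg[OF i w] y(2)] by simp
      then show "f (x i \<omega>) + (lam i \<omega> + e i) \<bullet> G i \<omega> \<le> f y"
        using x_le[OF i w y(1)] by linarith
    qed
    then show ?thesis
      using abs_inner_g_le[OF x_in[OF i w], of "e i"] unfolding inner_add_left by linarith
  qed
  have lG: "integrable M (\<lambda>\<omega>. lam i \<omega> \<bullet> G i \<omega>)" if "i \<ge> 1" for i
    using lam_G_int[OF that, of 0] by simp
  have Ef: "integral\<^sup>L M (\<lambda>\<omega>. f (x i \<omega>)) \<le> ?fs - ?I i + norm (e i) * s" if i: "i \<ge> 1" for i
  proof -
    have "integral\<^sup>L M (\<lambda>\<omega>. f (x i \<omega>))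
        \<le> integral\<^sup>L M (\<lambda>\<omega>. ?fs - lam i \<omega> \<bullet> G i \<omega> + norm (e i) * s)"
      by (rule integral_mono) (use fx_int[OF i] lG[OF i] pt[OF i] in auto)
    also have "\<dots> = ?fs - ?I i + norm (e i) * s"
      using lG[OF i] by (simp add: prob_space)
    finally show ?thesis .
  qed
  have "integral\<^sup>L M (\<lambda>\<omega>. f (xbar k \<omega>)) \<le> integral\<^sup>L M (\<lambda>\<omega>. (\<Sum>i=1..k. f (x i \<omega>)) / real k)"
  proof (rule integral_mono[OF f_xbar_int[OF k]])
    show "integrable M (\<lambda>\<omega>. (\<Sum>i=1..k. f (x i \<omega>)) / real k)"
      using fx_int by (intro integrable_divide Bochner_Integration.integrable_sum) auto
  qed (rule f_xbar_le[OF k])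
  also have "\<dots> = (\<Sum>i=1..k. integral\<^sup>L M (\<lambda>\<omega>. f (x i \<omega>))) / real k"
    using fx_int by (simp add: Bochner_Integration.integral_sum)
  also have "\<dots> \<le> (\<Sum>i=1..k. ?fs - ?I i + norm (e i) * s) / real k"
    using Ef by (intro divide_right_mono sum_mono) auto
  also have "\<dots> = ?fs - (\<Sum>i=1..k. ?I i) / real k + (\<Sum>i=1..k. norm (e i) * s) / real k"
    using k by (simp add: sum.distrib sum_subtractf add_divide_distrib diff_divide_distrib)
  finally have 1: "integral\<^sup>L M (\<lambda>\<omega>. f (xbar k \<omega>))
    \<le> ?fs - (\<Sum>i=1..k. ?I i) / real k + (\<Sum>i=1..k. norm (e i) * s) / real k" .
  \<comment> \<open>Dropping the nonnegative final distance in the telescoped bound with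
    \<open>v = 0\<close> leaves a lower bound on the sum of the \<open>?I i\<close>.\<close>
  have "0 \<le> integral\<^sup>L M (\<lambda>\<omega>. (norm (lam (Suc k) \<omega> - 0))\<^sup>2)"
    by (rule integral_nonneg_AE) simp
  also note lam_dist_sum[OF order_refl, of k]
  finally have "- (\<Sum>i=1..k. ?I i) * (2 * a) \<le> (norm lam1)\<^sup>2 + a\<^sup>2 * (s\<^sup>2 + sd\<^sup>2) * real k"
    by (simp add: algebra_simps)
  then have "- (\<Sum>i=1..k. ?I i) \<le> ((norm lam1)\<^sup>2 + a\<^sup>2 * (s\<^sup>2 + sd\<^sup>2) * real k) / (2 * a)"
    using a_pos by (simp add: pos_le_divide_eq)
  then have "- (\<Sum>i=1..k. ?I i) / real k
      \<le> ((norm lam1)\<^sup>2 + a\<^sup>2 * (s\<^sup>2 + sd\<^sup>2) * real k) / (2 * a) / real k"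
    by (rule divide_right_mono) simp
  also have "\<dots> = a * (s\<^sup>2 + sd\<^sup>2) / 2 + (norm lam1)\<^sup>2 / (2 * a * real k)"
    using a_pos k by (simp add: field_simps power2_eq_square)
  finally show ?thesis
    using 1 f_xbar_int[OF k] by (simp add: prob_space)
qed

text \<open>The positive part dominates its argument, so unrolling the update bounds the iterate
  from below by the accumulated increments. The noise enters linearly and drops out by its zero
  mean.\<close>

lemma expectation_lam_ge:
  "lam1 + a *\<^sub>R (\<Sum>i=1..k. integral\<^sup>L M (G i)) \<le> integral\<^sup>L M (lam (Suc k))"
proof (induction k)
  case 0
  have "integral\<^sup>L M (lam (Suc 0)) = integral\<^sup>L M (\<lambda>\<omega>. lam1)"
    by (rule Bochner_Integration.integral_cong) (use lam_1 in auto)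
  then show ?case by (simp add: prob_space)
next
  case (Suc k)
  let ?k = "Suc k"
  let ?h = "\<lambda>\<omega>. lam ?k \<omega> + a *\<^sub>R (G ?k \<omega> + (D ?k \<omega> - d))"
  have int: "integrable M (lam ?k)" "integrable M (G ?k)" "integrable M (D ?k)"
    using lam_int G_int D_int by auto
  have N: "integrable M (\<lambda>\<omega>. D ?k \<omega> - d)" "integral\<^sup>L M (\<lambda>\<omega>. D ?k \<omega> - d) = 0"
    using int(3) D_mean[of ?k] by (simp_all add: prob_space)
  note GN = Bochner_Integration.integrable_add[OF int(2) N(1)]
  note aGN = integrable_scaleR_right[OF GN, of a]
  note h = Bochner_Integration.integrable_add[OF int(1) aGN]
  have "lam1 + a *\<^sub>R (\<Sum>i=1..?k. integral\<^sup>L M (G i))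
      = lam1 + a *\<^sub>R (\<Sum>i=1..k. integral\<^sup>L M (G i)) + a *\<^sub>R integral\<^sup>L M (G ?k)"
    by (simp add: scaleR_add_right add.assoc)
  also have "\<dots> \<le> integral\<^sup>L M (lam ?k) + a *\<^sub>R integral\<^sup>L M (G ?k)"
    by (rule add_right_mono[OF Suc])
  also have "\<dots> = integral\<^sup>L M ?h"
    unfolding Bochner_Integration.integral_add[OF int(1) aGN] integral_scaleR_right
      Bochner_Integration.integral_add[OF int(2) N(1)] N(2) by simp
  also have "\<dots> \<le> integral\<^sup>L M (lam (Suc ?k))"
  proof (rule vec_integral_mono[OF h])
    show "?h \<omega> \<le> lam (Suc ?k) \<omega>" if "\<omega> \<in> space M" for \<omega>
      using pos_part_ge[of "lam ?k \<omega> + a *\<^sub>R (g (x ?k \<omega>) + D ?k \<omega>)"] lam_Suc[of ?k \<omega>] that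
      by (simp add: algebra_simps)
  qed (use lam_int in auto)
  finally show ?case .
qed

section \<open>Comparison with a maximizer of the dual function\<close>

context
  fixes ls :: "real ^ 'm"
  assumes ls_nonneg: "0 \<le> ls"
    and ls_max: "\<And>l. 0 \<le> l \<Longrightarrow> dual_fun X f g l d \<le> dual_fun X f g ls d"
begin

abbreviation "hs \<equiv> dual_fun X f g ls d"
abbreviation "Omega k \<equiv> (norm (lam1 - ls))\<^sup>2 + a\<^sup>2 * (s\<^sup>2 + sd\<^sup>2) * real k
  + 2 * a * (\<Sum>i=1..k. norm (e i) * s)"

text \<open>\<open>G i \<omega>\<close> is a supergradient of the concave dual function at the
  perturbed multiplier \<open>lam i \<omega> + e i\<close>, where \<open>x i \<omega>\<close>
  attains the infimum. Moving from there to the maximizer \<open>ls\<close> cannot lower the dual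
  value; the perturbation costs at most \<open>norm (e i) * s\<close>.\<close>

lemma lam_G_le:
  assumes i: "i \<ge> 1" and w: "\<omega> \<in> space M"
  shows "(lam i \<omega> - ls) \<bullet> G i \<omega> \<le> norm (e i) * s"
proof -
  have "f (x i \<omega>) + (lam i \<omega> + e i) \<bullet> G i \<omega> \<le> dual_fun X f g (lam i \<omega> + e i) d"
    unfolding dual_fun_def
    by (rule cINF_greatest[OF X_ne]) (use x_le[OF i w] in \<open>simp add: lagrangian_def\<close>)
  also have "\<dots> \<le> hs" by (rule ls_max[OF mu_nonneg[OF i w]])
  also have "\<dots> \<le> f (x i \<omega>) + ls \<bullet> G i \<omega>"
    by (rule dual_fun_le[OF bdd_lagrangian x_in[OF i w]])
  finally show ?thesis
    using abs_inner_g_le[OF x_in[OF i w], of "e i"]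
    unfolding inner_add_left inner_diff_left by linarith
qed

text \<open>Optimality of \<open>x i\<close> against \<open>y\<close> is combined with the lower
  bound \<open>hs\<close> on the Lagrangian at \<open>ls\<close>. The error \<open>e i\<close> is
  paired with the constraint values at both \<open>x i\<close> and \<open>y\<close>, hence the
  factor 2.\<close>

lemma lam_G_gap:
  assumes i: "i \<ge> 1" and w: "\<omega> \<in> space M" and y: "y \<in> X"
  shows "(lam i \<omega> - ls) \<bullet> G i \<omega> \<le> f y + lam i \<omega> \<bullet> (g y + d) - hs + 2 * (norm (e i) * s)"
  using x_le[OF i w y] dual_fun_le[OF bdd_lagrangian x_in[OF i w], of ls]
    abs_inner_g_le[OF x_in[OF i w], of "e i"] abs_inner_g_le[OF y, of "e i"]
  unfolding inner_add_left[of _ "e i"] inner_diff_left by linarith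

lemma lam_dist_le_Omega: "integral\<^sup>L M (\<lambda>\<omega>. (norm (lam (Suc k) \<omega> - ls))\<^sup>2) \<le> Omega k"
proof -
  have "integral\<^sup>L M (\<lambda>\<omega>. (lam i \<omega> - ls) \<bullet> G i \<omega>) \<le> norm (e i) * s" if i: "i \<ge> 1" for i
  proof -
    have "integral\<^sup>L M (\<lambda>\<omega>. (lam i \<omega> - ls) \<bullet> G i \<omega>) \<le> integral\<^sup>L M (\<lambda>\<omega>. norm (e i) * s)"
      by (rule integral_mono) (use lam_G_int[OF i] lam_G_le[OF i] in auto)
    then show ?thesis by (simp add: prob_space)
  qed
  then have "2 * a * (\<Sum>i=1..k. integral\<^sup>L M (\<lambda>\<omega>. (lam i \<omega> - ls) \<bullet> G i \<omega>))
      \<le> 2 * a * (\<Sum>i=1..k. norm (e i) * s)"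
    using a_pos by (intro mult_left_mono sum_mono) auto
  then show ?thesis using lam_dist_sum[OF ls_nonneg, of k] by linarith
qed

text \<open>By Jensen the second moment bounds the norm of the mean of
  \<open>lam (Suc k) - ls\<close>; the triangle inequality then restores \<open>ls\<close>.\<close>

lemma norm_expectation_lam_le: "norm (integral\<^sup>L M (lam (Suc k))) \<le> norm ls + sqrt (Omega k)"
proof -
  have i: "integrable M (\<lambda>\<omega>. lam (Suc k) \<omega> - ls)" using lam_int by simp
  have "(norm (integral\<^sup>L M (\<lambda>\<omega>. lam (Suc k) \<omega> - ls)))\<^sup>2 \<le> Omega k"
    using norm_expectation_sq_le[OF i lam_diff_sq] lam_dist_le_Omega[of k] by simp
  then have "norm (integral\<^sup>L M (\<lambda>\<omega>. lam (Suc k) \<omega> - ls)) \<le> sqrt (Omega k)"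
    by (rule real_le_rsqrt)
  then have "norm (integral\<^sup>L M (lam (Suc k)) - ls) \<le> sqrt (Omega k)"
    using lam_int by (simp add: prob_space)
  then show ?thesis
    using norm_triangle_ineq2[of "integral\<^sup>L M (lam (Suc k))" ls] by linarith
qed

text \<open>By convexity the mean constraint value at the average is at most the averaged mean
  constraint values, which \<open>expectation_lam_ge\<close> bounds by the mean of
  \<open>lam (Suc k)\<close> over \<open>a * real k\<close>.\<close>

lemma norm_pos_part_expectation_g_xbar_le:
  assumes k: "k \<ge> 1"
  shows "norm (pos_part (integral\<^sup>L M (\<lambda>\<omega>. g (xbar k \<omega>) + d)))
    \<le> 1 / (a * real k) * (norm ls + sqrt (Omega k))"
proof -
  let ?E = "integral\<^sup>L M (lam (Suc k))"
  let ?S = "\<Sum>i=1..k. integral\<^sup>L M (G i)"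
  have "integral\<^sup>L M (\<lambda>\<omega>. g (xbar k \<omega>) + d) \<le> integral\<^sup>L M (\<lambda>\<omega>. (1 / real k) *\<^sub>R (\<Sum>i=1..k. G i \<omega>))"
  proof (rule vec_integral_mono[OF g_xbar_int[OF k]])
    show "integrable M (\<lambda>\<omega>. (1 / real k) *\<^sub>R (\<Sum>i=1..k. G i \<omega>))"
      using G_int by (intro integrable_scaleR_right Bochner_Integration.integrable_sum) auto
  qed (rule g_xbar_le[OF k])
  also have "\<dots> = (1 / real k) *\<^sub>R ?S"
    unfolding integral_scaleR_right
    by (subst Bochner_Integration.integral_sum) (use G_int in auto)
  also have "\<dots> \<le> (1 / (a * real k)) *\<^sub>R ?E"
  proof -
    have "a *\<^sub>R ?S \<le> ?E"
      using expectation_lam_ge[of k] lam1_nonneg by (meson add_increasing order_trans order_refl)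
    then have "(1 / (a * real k)) *\<^sub>R (a *\<^sub>R ?S) \<le> (1 / (a * real k)) *\<^sub>R ?E"
      using a_pos by (intro scaleR_left_mono) auto
    then show ?thesis using a_pos by simp
  qed
  finally have "integral\<^sup>L M (\<lambda>\<omega>. g (xbar k \<omega>) + d) \<le> (1 / (a * real k)) *\<^sub>R ?E" .
  \<comment> \<open>Since the upper bound is nonnegative, it also bounds the positive part.\<close>
  moreover have "0 \<le> ?E"
    using vec_integral_mono[of M "\<lambda>\<omega>. 0" "lam (Suc k)"] lam_int lam_nonneg by simp
  then have "0 \<le> (1 / (a * real k)) *\<^sub>R ?E"
    using a_pos by (intro scaleR_nonneg_nonneg) auto
  ultimately have "norm (pos_part (integral\<^sup>L M (\<lambda>\<omega>. g (xbar k \<omega>) + d))) \<le> norm ((1 / (a * real k)) *\<^sub>R ?E)"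
    by (rule norm_pos_part_le)
  also have "\<dots> = 1 / (a * real k) * norm ?E"
    using a_pos by simp
  also have "\<dots> \<le> 1 / (a * real k) * (norm ls + sqrt (Omega k))"
    using norm_expectation_lam_le[of k] a_pos by (intro mult_left_mono) auto
  finally show ?thesis .
qed

lemma expectation_lbar_nonneg: "0 \<le> integral\<^sup>L M (lbar k)"
proof -
  have "0 \<le> integral\<^sup>L M (lam i)" if "i \<in> {1..k}" for i
    using vec_integral_mono[of M "\<lambda>\<omega>. 0" "lam i"] lam_int lam_nonneg that by simp
  then show ?thesis
    unfolding expectation_lbar by (intro scaleR_nonneg_nonneg sum_nonneg) auto
qed

text \<open>Read over all \<open>y\<close> in \<open>X\<close>, this says that the mean of
  \<open>lbar k\<close> is dual optimal up to \<open>Omega k / (a * real k)\<close>. Both remaining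
  bounds follow by choosing \<open>y\<close>.\<close>

lemma dual_gap_at_lbar:
  assumes k: "k \<ge> 1" and y: "y \<in> X"
  shows "hs - Omega k / (a * real k) \<le> f y + integral\<^sup>L M (lbar k) \<bullet> (g y + d)"
proof -
  let ?v = "g y + d"
  let ?L = "integral\<^sup>L M (lbar k)"
  let ?e = "\<Sum>i=1..k. norm (e i) * s"
  have "integral\<^sup>L M (\<lambda>\<omega>. (lam i \<omega> - ls) \<bullet> G i \<omega>)
      \<le> (f y - hs) + integral\<^sup>L M (lam i) \<bullet> ?v + 2 * (norm (e i) * s)" if i: "i \<ge> 1" for i
  proof -
    have "integral\<^sup>L M (\<lambda>\<omega>. (lam i \<omega> - ls) \<bullet> G i \<omega>)
        \<le> integral\<^sup>L M (\<lambda>\<omega>. (f y - hs) + lam i \<omega> \<bullet> ?v + 2 * (norm (e i) * s))"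
    proof (rule integral_mono[OF lam_G_int[OF i]])
      show "integrable M (\<lambda>\<omega>. (f y - hs) + lam i \<omega> \<bullet> ?v + 2 * (norm (e i) * s))"
        using lam_int[OF i]
        by (intro Bochner_Integration.integrable_add integrable_inner_left integrable_const)
      show "(lam i \<omega> - ls) \<bullet> G i \<omega> \<le> (f y - hs) + lam i \<omega> \<bullet> ?v + 2 * (norm (e i) * s)"
        if "\<omega> \<in> space M" for \<omega>
        using lam_G_gap[OF i that y] by linarith
    qed
    also have "\<dots> = (f y - hs) + integral\<^sup>L M (lam i) \<bullet> ?v + 2 * (norm (e i) * s)"
    proof -
      have "integrable M (\<lambda>\<omega>. lam i \<omega> \<bullet> ?v)" using lam_int[OF i] by (intro integrable_inner_left)
      moreover have "integral\<^sup>L M (\<lambda>\<omega>. lam i \<omega> \<bullet> ?v) = integral\<^sup>L M (lam i) \<bullet> ?v"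
        using lam_int[OF i] by (intro integral_inner_left)
      ultimately show ?thesis
        by (simp add: prob_space del: inner_add_right)
    qed
    finally show ?thesis .
  qed
  then have "(\<Sum>i=1..k. integral\<^sup>L M (\<lambda>\<omega>. (lam i \<omega> - ls) \<bullet> G i \<omega>))
      \<le> (\<Sum>i=1..k. (f y - hs) + integral\<^sup>L M (lam i) \<bullet> ?v + 2 * (norm (e i) * s))"
    by (intro sum_mono) auto
  also have "\<dots> = real k * (f y - hs) + (\<Sum>i=1..k. integral\<^sup>L M (lam i)) \<bullet> ?v + 2 * ?e"
    by (simp only: sum.distrib inner_sum_left sum_distrib_left sum_constant card_atLeastAtMost) simp
  also have "(\<Sum>i=1..k. integral\<^sup>L M (lam i)) = real k *\<^sub>R ?L"
    using k by (simp add: expectation_lbar)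
  finally have 1: "(\<Sum>i=1..k. integral\<^sup>L M (\<lambda>\<omega>. (lam i \<omega> - ls) \<bullet> G i \<omega>))
      \<le> real k * (f y - hs + ?L \<bullet> ?v) + 2 * ?e"
    by (simp only: inner_scaleR_left distrib_left)
  have "0 \<le> integral\<^sup>L M (\<lambda>\<omega>. (norm (lam (Suc k) \<omega> - ls))\<^sup>2)"
    by (rule integral_nonneg_AE) simp
  also note lam_dist_sum[OF ls_nonneg, of k]
  finally have "0 \<le> (norm (lam1 - ls))\<^sup>2 + a\<^sup>2 * (s\<^sup>2 + sd\<^sup>2) * real k
      + 2 * a * (real k * (f y - hs + ?L \<bullet> ?v) + 2 * ?e)"
    using mult_left_mono[OF 1, of "2 * a"] a_pos by linarith
  also have "\<dots> = (norm (lam1 - ls))\<^sup>2 + a\<^sup>2 * (s\<^sup>2 + sd\<^sup>2) * real k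
      + 2 * (a * real k * (f y - hs + ?L \<bullet> ?v)) + 2 * (2 * a * ?e)"
    by (simp only: distrib_left mult.assoc mult.left_commute[of a 2])
  finally have "0 \<le> (norm (lam1 - ls))\<^sup>2 + a\<^sup>2 * (s\<^sup>2 + sd\<^sup>2) * real k
      + 2 * (a * real k * (f y - hs + ?L \<bullet> ?v)) + 2 * (2 * a * ?e)" .
  \<comment> \<open>Halving the last inequality leaves half of the two nonnegative terms of
    \<open>Omega k\<close> and all of its error term; counting those two terms in full gives
    \<open>Omega k\<close>.\<close>
  moreover have nn: "0 \<le> a\<^sup>2 * (s\<^sup>2 + sd\<^sup>2) * real k" by simp
  ultimately have "0 \<le> Omega k + a * real k * (f y - hs + ?L \<bullet> ?v)"
    using nn zero_le_power2[of "norm (lam1 - ls)"] by linarith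
  then have "- Omega k \<le> (f y - hs + ?L \<bullet> ?v) * (a * real k)"
    by (simp only: mult.commute[of _ "a * real k"])
  then have "- Omega k / (a * real k) \<le> f y - hs + ?L \<bullet> ?v"
    using a_pos k by (subst pos_divide_le_eq) auto
  then show ?thesis
    unfolding minus_divide_left[symmetric] by linarith
qed

lemma expectation_f_xbar_ge:
  assumes k: "k \<ge> 1" and fs: "opt_value X f g d \<le> hs"
  shows "- ((Omega k + norm (integral\<^sup>L M (lbar k)) * (norm ls + sqrt (Omega k))) / (a * real k))
    \<le> integral\<^sup>L M (\<lambda>\<omega>. f (xbar k \<omega>) - opt_value X f g d)"
proof -
  let ?L = "integral\<^sup>L M (lbar k)"
  let ?g = "integral\<^sup>L M (\<lambda>\<omega>. g (xbar k \<omega>) + d)"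
  note gi = g_xbar_int[OF k]
  \<comment> \<open>The multiplier \<open>?L\<close> is deterministic, so the gap inequality may be
    applied pointwise at the random point \<open>xbar k \<omega>\<close> and then
    integrated.\<close>
  have "integral\<^sup>L M (\<lambda>\<omega>. hs - Omega k / (a * real k))
      \<le> integral\<^sup>L M (\<lambda>\<omega>. f (xbar k \<omega>) + ?L \<bullet> (g (xbar k \<omega>) + d))"
    using f_xbar_int[OF k] integrable_inner_right[OF gi] dual_gap_at_lbar[OF k xbar_in[OF k]]
    by (intro integral_mono Bochner_Integration.integrable_add integrable_const) auto
  also have "\<dots> = integral\<^sup>L M (\<lambda>\<omega>. f (xbar k \<omega>)) + ?L \<bullet> ?g"
    using f_xbar_int[OF k] integrable_inner_right[OF gi] integral_inner_right[OF gi]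
    by (simp only: Bochner_Integration.integral_add)
  finally have 1: "hs - Omega k / (a * real k) \<le> integral\<^sup>L M (\<lambda>\<omega>. f (xbar k \<omega>)) + ?L \<bullet> ?g"
    by (simp add: prob_space)
  \<comment> \<open>Only the positive part of the mean constraint value is controlled;
    \<open>?L\<close> being nonnegative allows passing to it.\<close>
  have "?L \<bullet> ?g \<le> ?L \<bullet> pos_part ?g"
    by (rule inner_vec_mono[OF expectation_lbar_nonneg pos_part_ge])
  also have "\<dots> \<le> norm ?L * norm (pos_part ?g)" by (rule norm_cauchy_schwarz)
  also have "\<dots> \<le> norm ?L * (1 / (a * real k) * (norm ls + sqrt (Omega k)))"
    by (rule mult_left_mono[OF norm_pos_part_expectation_g_xbar_le[OF k]]) simp
  also have "\<dots> = norm ?L * (norm ls + sqrt (Omega k)) / (a * real k)" by simp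
  finally have "hs - Omega k / (a * real k) - norm ?L * (norm ls + sqrt (Omega k)) / (a * real k)
      \<le> integral\<^sup>L M (\<lambda>\<omega>. f (xbar k \<omega>))"
    using 1 by linarith
  moreover have "integral\<^sup>L M (\<lambda>\<omega>. f (xbar k \<omega>) - opt_value X f g d)
      = integral\<^sup>L M (\<lambda>\<omega>. f (xbar k \<omega>)) - opt_value X f g d"
    using f_xbar_int[OF k] by (simp add: prob_space)
  ultimately show ?thesis
    using fs unfolding add_divide_distrib by linarith
qed

text \<open>At a Slater point the multiplier term of the gap inequality is at most minus the margin
  times the norm of the multiplier.\<close>

lemma norm_expectation_lbar_le:
  assumes k: "k \<ge> 1" and y: "slater_point X g d y"
  shows "norm (integral\<^sup>L M (lbar k)) \<le> 1 / slater_margin g d y * (f y - hs + Omega k / (a * real k))"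
proof -
  let ?L = "integral\<^sup>L M (lbar k)"
  have "slater_margin g d y * norm ?L \<le> - (?L \<bullet> (g y + d))"
    by (rule slater_margin_norm_le[OF expectation_lbar_nonneg y])
  also have "\<dots> \<le> f y - hs + Omega k / (a * real k)"
    using dual_gap_at_lbar[OF k, of y] y by (simp add: slater_point_def del: inner_add_right)
  finally show ?thesis
    using slater_margin_pos[OF y] by (simp add: pos_le_divide_eq mult.commute)
qed

end

end

section \<open>The four bounds together\<close>

theorem theorem1:
  fixes X :: "(real ^ 'n) set"
    and f :: "real ^ 'n \<Rightarrow> real"
    and g :: "real ^ 'n \<Rightarrow> real ^ 'm"
    and \<delta> :: "real ^ 'm"
    and M :: "'w measure"
    and \<Delta> :: "nat \<Rightarrow> 'w \<Rightarrow> real ^ 'm"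
    and x :: "nat \<Rightarrow> 'w \<Rightarrow> real ^ 'n"
    and lam :: "nat \<Rightarrow> 'w \<Rightarrow> real ^ 'm"
    and e :: "nat \<Rightarrow> real ^ 'm"
    and lam1 lamstar :: "real ^ 'm"
    and \<alpha> \<epsilon> \<sigma>\<^sub>g \<sigma>\<^sub>\<delta> :: real
  assumes "bounded X" and "convex X"
    and "convex_on X f" and "\<And>j. convex_on X (\<lambda>y. g y $ j)"
    and "f \<in> borel_measurable (restrict_space borel X)"
    and "g \<in> borel_measurable (restrict_space borel X)"
    and "\<And>y. y \<in> X \<Longrightarrow> norm (g y + \<delta>) \<le> \<sigma>\<^sub>g"
    and "rel_interior (feasible_set X g \<delta>) \<noteq> {}"
    and "\<exists>y. slater_point X g \<delta> y"
    and "is_arg_max (\<lambda>l. dual_fun X f g l \<delta>) (\<lambda>l. 0 \<le> l) lamstar"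
    and "prob_space M"
    and "ergodic_process M \<Delta> \<delta>"
    and "\<And>k. k \<ge> 1 \<Longrightarrow> integrable M (\<lambda>\<omega>. (norm (\<Delta> k \<omega> - \<delta>))\<^sup>2)"
    and "\<And>k. k \<ge> 1 \<Longrightarrow> integral\<^sup>L M (\<lambda>\<omega>. (norm (\<Delta> k \<omega> - \<delta>))\<^sup>2) = \<sigma>\<^sub>\<delta>\<^sup>2"
    and "\<And>k. k \<ge> 1 \<Longrightarrow> indep_rvs M (\<Delta> k) (lam k)"
    and "\<And>k. k \<ge> 1 \<Longrightarrow> indep_rvs M (\<Delta> k) (x k)"
    and "\<alpha> > 0"
    and "0 \<le> lam1"
    and "\<And>\<omega>. \<omega> \<in> space M \<Longrightarrow> lam 1 \<omega> = lam1"
    and "\<And>k \<omega>. k \<ge> 1 \<Longrightarrow> \<omega> \<in> space M \<Longrightarrow> 0 \<le> lam k \<omega> + e k"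
    and "\<And>k \<omega>. k \<ge> 1 \<Longrightarrow> \<omega> \<in> space M \<Longrightarrow>
           is_arg_min (\<lambda>y. lagrangian f g y (lam k \<omega> + e k) (\<Delta> k \<omega>)) (\<lambda>y. y \<in> X) (x k \<omega>)"
    and "\<And>k \<omega>. k \<ge> 1 \<Longrightarrow> \<omega> \<in> space M \<Longrightarrow>
           lam (Suc k) \<omega> = pos_part (lam k \<omega> + \<alpha> *\<^sub>R (g (x k \<omega>) + \<Delta> k \<omega>))"
    and "\<epsilon> \<ge> 0"
    and "(\<lambda>k. (\<Sum>i=1..k. norm (e i)) / real k) \<longlonglongrightarrow> \<epsilon>"
  shows "\<forall>k\<ge>1.
    let xbar = (\<lambda>\<omega>. running_avg (\<lambda>i. x i \<omega>) k);
        lbar = (\<lambda>\<omega>. running_avg (\<lambda>i. lam i \<omega>) k);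
        \<Theta> = \<sigma>\<^sub>g\<^sup>2 + \<sigma>\<^sub>\<delta>\<^sup>2;
        \<Omega> = (norm (lam1 - lamstar))\<^sup>2 + \<alpha>\<^sup>2 * \<Theta> * real k
              + 2 * \<alpha> * (\<Sum>i=1..k. norm (e i) * \<sigma>\<^sub>g)
    in
      integral\<^sup>L M (\<lambda>\<omega>. f (xbar \<omega>) - opt_value X f g \<delta>)
        \<le> \<alpha> * \<Theta> / 2 + (norm lam1)\<^sup>2 / (2 * \<alpha> * real k)
            + 2 / real k * (\<Sum>i=1..k. norm (e i) * \<sigma>\<^sub>g)
    \<and> integral\<^sup>L M (\<lambda>\<omega>. f (xbar \<omega>) - opt_value X f g \<delta>)
        \<ge> - ((\<Omega> + norm (integral\<^sup>L M lbar) * (norm lamstar + sqrt \<Omega>)) / (\<alpha> * real k))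
    \<and> norm (pos_part (integral\<^sup>L M (\<lambda>\<omega>. g (xbar \<omega>) + \<delta>)))
        \<le> 1 / (\<alpha> * real k) * (norm lamstar + sqrt \<Omega>)
    \<and> (\<forall>xhat. slater_point X g \<delta> xhat \<longrightarrow>
        norm (integral\<^sup>L M lbar)
          \<le> 1 / slater_margin g \<delta> xhat
              * (f xhat - dual_fun X f g lamstar \<delta> + \<Omega> / (\<alpha> * real k)))"
proof -
  interpret prob_space M by fact
  interpret dual_update M X f g \<delta> \<Delta> x lam e lam1 \<alpha> \<sigma>\<^sub>g \<sigma>\<^sub>\<delta>
  proof unfold_locales
    show "integrable M (\<Delta> k)" "integral\<^sup>L M (\<Delta> k) = \<delta>" if "k \<ge> 1" for k
      using assms(12) that by (auto simp: ergodic_process_def)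
  qed (fact assms)+
  obtain y where y: "slater_point X g \<delta> y" using assms(9) by blast
  then have feas: "feasible_set X g \<delta> \<noteq> {}"
    by (force simp: slater_point_def feasible_set_def less_eq_vec_def intro: less_imp_le)
  have ls: "0 \<le> lamstar" "\<And>l. 0 \<le> l \<Longrightarrow> dual_fun X f g l \<delta> \<le> dual_fun X f g lamstar \<delta>"
    using assms(10) by (auto simp: is_arg_max_linorder)
  \<comment> \<open>Some multiplier has no duality gap; as \<open>lamstar\<close> maximizes the dual
    function, it has none either.\<close>
  obtain l where "0 \<le> l" "opt_value X f g \<delta> \<le> dual_fun X f g l \<delta>"
    using slater_strong_duality[OF cf cg y bdd_f] by blast
  with ls(2) have fs: "opt_value X f g \<delta> \<le> dual_fun X f g lamstar \<delta>"
    using order_trans by blast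
  show ?thesis
    unfolding Let_def
  proof (intro allI impI conjI)
    fix k :: nat assume k: "1 \<le> k"
    let ?e = "\<Sum>i=1..k. norm (e i) * \<sigma>\<^sub>g"
    \<comment> \<open>The derived bound carries the error sum with factor 1; it is relaxed to 2
      because the sum is nonnegative.\<close>
    have "0 \<le> ?e" using s_nonneg by (intro sum_nonneg) auto
    then have "?e / real k \<le> 2 / real k * ?e"
      by (simp add: divide_right_mono)
    then show "integral\<^sup>L M (\<lambda>\<omega>. f (xbar k \<omega>) - opt_value X f g \<delta>)
        \<le> \<alpha> * (\<sigma>\<^sub>g\<^sup>2 + \<sigma>\<^sub>\<delta>\<^sup>2) / 2 + (norm lam1)\<^sup>2 / (2 * \<alpha> * real k) + 2 / real k * ?e"
      using expectation_f_xbar_le[OF k feas] by linarith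
  qed (rule expectation_f_xbar_ge[OF ls _ fs] norm_pos_part_expectation_g_xbar_le[OF ls]
      norm_expectation_lbar_le[OF ls]; assumption)+
qed

end
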